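(* Let $\mathbf{i},\mathbf{i}'\in\mathbb{I}(n)$ with $\mathbf{i}^2=(\mathbf{i}')^2=-1$, let $\varepsilon\in\{-1,1\}$, and let $U\subseteq\mathbb{M}\mathbb{C}(n)$ be an open set. There exists an $\mathbb{I}(n)$-preserving automorphism $\psi$ of $\mathbb{M}\mathbb{C}(n)$ with $\psi(\mathbf{i})=\varepsilon\,\mathbf{i}'$, and for any such $\psi$, $$\{F\in C^1(U): DF(\eta)\circ\mathcal{L}_{\mathbf{i}}=\varepsilon\,\mathcal{L}_{\mathbf{i}'}\circ DF(\eta),\ \eta\in U\}=\{\psi\circ G: G\in\mathrm{Hol}_{\mathbf{i}}(U)\}.$$ In particular, every such twisted class (the set on the left-hand side) consists of real-analytic functions and is obtained from an $\mathbf{i}$-holomorphy class by post-composition with a single fixed $\mathbb{I}(n)$-preserving automorphism.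
   Context: Let $n\ge1$. The multicomplex numbers are defined recursively by $\mathbb{M}\mathbb{C}(0)=\mathbb{R}$ and $\mathbb{M}\mathbb{C}(n)=\{\eta_1+\eta_2\mathbf{i}_n:\eta_1,\eta_2\in\mathbb{M}\mathbb{C}(n-1)\}$ with $\mathbf{i}_n^2=-1$, where $\mathbf{i}_n$ is a new formal square root of $-1$ commuting with everything. Thus $\mathbb{M}\mathbb{C}(n)$ is a commutative unital real algebra of dimension $2^n$ generated by commuting units $\mathbf{i}_1,\dots,\mathbf{i}_n$ with $\mathbf{i}_k^2=-1$, with real basis $\mathbb{I}(n):=\{\mathbf{i}_1^{a_1}\cdots\mathbf{i}_n^{a_n}: a_k\in\{0,1\}\}$. Put $\pm\mathbb{I}(n):=\{\pm\mathbf{j}:\mathbf{j}\in\mathbb{I}(n)\}$. An $\mathbb{I}(n)$-preserving automorphism is a real-algebra automorphism of $\mathbb{M}\mathbb{C}(n)$ (not necessarily an involution) mapping $\mathbb{I}(n)$ into $\pm\mathbb{I}(n)$. $C^1(U)$ is the set of functions $F:U\to\mathbb{M}\mathbb{C}(n)$ that are continuously differentiable as maps between real vector spaces, and $DF(\eta)$ is the real differential. For $\mathbf{j}\in\mathbb{I}(n)$, $\mathcal{L}_{\mathbf{j}}(\eta)=\mathbf{j}\eta$. $\mathrm{Hol}_{\mathbf{i}}(U)$ (the $\mathbf{i}$-holomorphy class) is the set of $G\in C^1(U)$ with $DG(\eta)\circ\mathcal{L}_{\mathbf{i}}=\mathcal{L}_{\mathbf{i}}\circ DG(\eta)$ for every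 $\eta\in U$. *)

theory Defs
  imports "HOL-Analysis.Analysis"
begin

section \<open>Multicomplex numbers\<close>

text \<open>
  The \<open>n\<close>-th multicomplex algebra is rendered with a finite index type \<open>'n\<close> for the generators
  \<open>i\<^sub>1, \<dots>, i\<^sub>n\<close>, so \<open>n = CARD('n)\<close> is an arbitrary number \<open>\<ge> 1\<close>. An element is its family of
  \<open>2 ^ n\<close> real coordinates; the coordinate at \<open>A\<close> belongs to the product of the \<open>i\<^sub>k\<close> with \<open>k \<in> A\<close>.
  The multiplication is forced by commutativity and \<open>i\<^sub>k\<^sup>2 = -1\<close>: the units at \<open>A\<close> and \<open>B\<close> multiply
  to \<open>(-1) ^ card (A \<inter> B)\<close> times the unit at the symmetric difference. The recursive construction
  by adjoining one new square root of \<open>-1\<close> at a time is recovered in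
  \<open>mc_sub_empty\<close>, \<open>mc_sub_insert\<close>, \<open>mc_sub_insert_unique\<close> and \<open>mc_sub_UNIV\<close> below.
\<close>

typedef 'n multicomplex = "UNIV :: ('n set \<Rightarrow> real) set"
  morphisms mcoeff Multicomplex by simp

lemma mcoeff_Multicomplex [simp]: "mcoeff (Multicomplex f) = f"
  by (simp add: Multicomplex_inverse)

lemma mc_eq_iff: "x = y \<longleftrightarrow> (\<forall>A. mcoeff x A = mcoeff y A)"
  by (metis ext mcoeff_inject)

lemma mc_eqI: "(\<And>A. mcoeff x A = mcoeff y A) \<Longrightarrow> x = y"
  by (simp add: mc_eq_iff)

instantiation multicomplex :: (type) real_vector
begin

definition "0 = Multicomplex (\<lambda>_. 0)"
definition "x + y = Multicomplex (\<lambda>A. mcoeff x A + mcoeff y A)"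
definition "x - y = Multicomplex (\<lambda>A. mcoeff x A - mcoeff y A)"
definition "- x = Multicomplex (\<lambda>A. - mcoeff x A)"
definition "r *\<^sub>R x = Multicomplex (\<lambda>A. r * mcoeff x A)"

instance
  by standard
    (auto simp: mc_eq_iff zero_multicomplex_def plus_multicomplex_def minus_multicomplex_def
      uminus_multicomplex_def scaleR_multicomplex_def algebra_simps)

end

lemma mcoeff_simps [simp]:
  "mcoeff 0 A = 0"
  "mcoeff (x + y) A = mcoeff x A + mcoeff y A"
  "mcoeff (x - y) A = mcoeff x A - mcoeff y A"
  "mcoeff (- x) A = - mcoeff x A"
  "mcoeff (r *\<^sub>R x) A = r * mcoeff x A"
  by (simp_all add: zero_multicomplex_def plus_multicomplex_def minus_multicomplex_def
      uminus_multicomplex_def scaleR_multicomplex_def)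

definition mc_unit :: "'n set \<Rightarrow> 'n multicomplex" where
  "mc_unit A = Multicomplex (\<lambda>B. if B = A then 1 else 0)"

lemma mcoeff_unit: "mcoeff (mc_unit A) B = (if B = A then 1 else 0)"
  by (simp add: mc_unit_def)

instantiation multicomplex :: (finite) "{one, times}"
begin

definition "1 = (mc_unit {} :: 'a multicomplex)"

definition times_multicomplex :: "'a multicomplex \<Rightarrow> 'a multicomplex \<Rightarrow> 'a multicomplex" where
  "x * y = Multicomplex (\<lambda>C. \<Sum>(A, B) | sym_diff A B = C.
     (- 1) ^ card (A \<inter> B) * mcoeff x A * mcoeff y B)"

instance ..

end

lemma neg_one_card_Int:
  "(- 1 :: real) ^ card (A \<inter> B) = (\<Prod>k\<in>UNIV. if k \<in> A \<and> k \<in> B then - 1 else 1)"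
  for A B :: "'n::finite set"
proof -
  have "(\<Prod>k\<in>UNIV. if k \<in> A \<and> k \<in> B then - 1 else (1::real)) = (\<Prod>k\<in>A \<inter> B. - 1)"
    by (rule prod.mono_neutral_cong_right) auto
  then show ?thesis by simp
qed

lemma mcoeff_times:
  "mcoeff (x * y) C =
     (\<Sum>A\<in>UNIV. (- 1) ^ card (A \<inter> sym_diff A C) * mcoeff x A * mcoeff y (sym_diff A C))"
  for x y :: "'n::finite multicomplex"
proof -
  have *: "{(A, B). sym_diff A B = C} = (\<lambda>A. (A, sym_diff A C)) ` UNIV"
    by (auto simp: image_iff)
  have inj: "inj (\<lambda>A. (A, sym_diff A C))" by (auto simp: inj_on_def)
  show ?thesis
    unfolding times_multicomplex_def mcoeff_Multicomplex * sum.reindex[OF inj] by simp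
qed

lemma mc_unit_mult:
  "mc_unit A * mc_unit B = (- 1) ^ card (A \<inter> B) *\<^sub>R mc_unit (sym_diff A B)"
  for A B :: "'n::finite set"
proof (rule mc_eqI)
  fix C
  have "mcoeff (mc_unit A * mc_unit B) C =
      (\<Sum>D\<in>UNIV. if D = A then (- 1) ^ card (A \<inter> sym_diff A C) * mcoeff (mc_unit B) (sym_diff A C) else 0)"
    unfolding mcoeff_times by (rule sum.cong) (auto simp: mcoeff_unit)
  also have "\<dots> = (- 1) ^ card (A \<inter> sym_diff A C) * mcoeff (mc_unit B) (sym_diff A C)"
    by simp
  also have "\<dots> = mcoeff ((- 1) ^ card (A \<inter> B) *\<^sub>R mc_unit (sym_diff A B)) C"
  proof (cases "C = sym_diff A B")
    case True
    then have "sym_diff A C = B" by auto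
    with True show ?thesis by (simp add: mcoeff_unit)
  next
    case False
    then have "sym_diff A C \<noteq> B" by auto
    with False show ?thesis by (simp add: mcoeff_unit)
  qed
  finally show "mcoeff (mc_unit A * mc_unit B) C =
    mcoeff ((- 1) ^ card (A \<inter> B) *\<^sub>R mc_unit (sym_diff A B)) C" .
qed

instance multicomplex :: (finite) "{comm_ring_1, real_algebra_1}"
proof
  fix x y z :: "'a multicomplex" and r :: real
  show comm: "x * y = y * x" for x y :: "'a multicomplex"
  proof (rule mc_eqI)
    fix C :: "'a set"
    have bij: "bij_betw (\<lambda>A. sym_diff A C) UNIV UNIV"
      by (rule bij_betwI[where g = "\<lambda>A. sym_diff A C"]) auto
    have inv: "sym_diff (sym_diff A C) C = A" for A by auto
    show "mcoeff (x * y) C = mcoeff (y * x) C"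
      unfolding mcoeff_times
      by (subst (2) sum.reindex_bij_betw[OF bij, symmetric])
        (simp only: inv Int_commute mult.commute mult.left_commute)
  qed
  show "(x * y) * z = x * (y * z)"
  proof (rule mc_eqI)
    fix D :: "'a set"
    have term_eq: "(- 1) ^ card (A \<inter> sym_diff A D) * ((- 1) ^ card (B \<inter> sym_diff B A) * mcoeff x B * mcoeff y (sym_diff B A)) * mcoeff z (sym_diff A D)
       = (- 1) ^ card (B \<inter> sym_diff B D) * mcoeff x B * ((- 1) ^ card (sym_diff B A \<inter> sym_diff (sym_diff B A) (sym_diff B D)) * mcoeff y (sym_diff B A) * mcoeff z (sym_diff (sym_diff B A) (sym_diff B D)))"
      for A B
    proof -
      have e: "sym_diff (sym_diff B A) (sym_diff B D) = sym_diff A D" by auto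
      have "(- 1 :: real) ^ card (A \<inter> sym_diff A D) * (- 1) ^ card (B \<inter> sym_diff B A) =
        (- 1) ^ card (B \<inter> sym_diff B D) * (- 1) ^ card (sym_diff B A \<inter> sym_diff A D)"
        unfolding neg_one_card_Int prod.distrib[symmetric] by (rule prod.cong) auto
      then show ?thesis unfolding e by (simp only: mult_ac)
    qed
    have "mcoeff (x * y * z) D = (\<Sum>A\<in>UNIV. \<Sum>B\<in>UNIV. (- 1) ^ card (A \<inter> sym_diff A D) *
        ((- 1) ^ card (B \<inter> sym_diff B A) * mcoeff x B * mcoeff y (sym_diff B A)) * mcoeff z (sym_diff A D))"
      unfolding mcoeff_times[of "x * y"] mcoeff_times[of x y]
      by (simp only: sum_distrib_left sum_distrib_right)
    also have "\<dots> = (\<Sum>B\<in>UNIV. \<Sum>A\<in>UNIV. (- 1) ^ card (B \<inter> sym_diff B D) * mcoeff x B * ((- 1) ^ card (sym_diff B A \<inter> sym_diff (sym_diff B A) (sym_diff B D)) * mcoeff y (sym_diff B A) * mcoeff z (sym_diff (sym_diff B A) (sym_diff B D))))"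
      by (subst sum.swap) (simp only: term_eq)
    also have "\<dots> = (\<Sum>B\<in>UNIV. \<Sum>E\<in>UNIV. (- 1) ^ card (B \<inter> sym_diff B D) * mcoeff x B * ((- 1) ^ card (E \<inter> sym_diff E (sym_diff B D)) * mcoeff y E * mcoeff z (sym_diff E (sym_diff B D))))"
    proof (rule sum.cong[OF refl])
      fix B :: "'a set"
      have bij: "bij_betw (\<lambda>A. sym_diff B A) UNIV UNIV"
        by (rule bij_betwI[where g = "\<lambda>A. sym_diff B A"]) auto
      show "(\<Sum>A\<in>UNIV. (- 1) ^ card (B \<inter> sym_diff B D) * mcoeff x B * ((- 1) ^ card (sym_diff B A \<inter> sym_diff (sym_diff B A) (sym_diff B D)) * mcoeff y (sym_diff B A) * mcoeff z (sym_diff (sym_diff B A) (sym_diff B D))))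
        = (\<Sum>E\<in>UNIV. (- 1) ^ card (B \<inter> sym_diff B D) * mcoeff x B * ((- 1) ^ card (E \<inter> sym_diff E (sym_diff B D)) * mcoeff y E * mcoeff z (sym_diff E (sym_diff B D))))"
        by (rule sum.reindex_bij_betw[OF bij])
    qed
    also have "\<dots> = mcoeff (x * (y * z)) D"
      unfolding mcoeff_times[of x "y * z"] mcoeff_times[of y z]
      by (simp only: sum_distrib_left)
    finally show "mcoeff (x * y * z) D = mcoeff (x * (y * z)) D" .
  qed
  show "(x + y) * z = x * z + y * z"
    by (rule mc_eqI) (simp add: mcoeff_times sum.distrib algebra_simps)
  show one: "1 * x = x" for x :: "'a multicomplex"
  proof (rule mc_eqI)
    fix C :: "'a set"
    have "mcoeff (1 * x) C = (\<Sum>A\<in>(UNIV :: 'a set set). if A = {} then mcoeff x C else 0)"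
      unfolding mcoeff_times one_multicomplex_def by (rule sum.cong) (auto simp: mcoeff_unit)
    then show "mcoeff (1 * x) C = mcoeff x C" by simp
  qed
  show sc: "r *\<^sub>R x * y = r *\<^sub>R (x * y)" for x y :: "'a multicomplex"
    by (rule mc_eqI) (simp add: mcoeff_times sum_distrib_left mult_ac)
  show "x * r *\<^sub>R y = r *\<^sub>R (x * y)"
    by (metis comm sc)
  show "x * (y + z) = x * y + x * z"
    by (rule mc_eqI) (simp add: mcoeff_times sum.distrib algebra_simps)
  show "x * 1 = x" by (metis comm one)
  show "(0 :: 'a multicomplex) \<noteq> 1"
    by (auto simp: mc_eq_iff one_multicomplex_def mcoeff_unit)
qed

instantiation multicomplex :: (finite) euclidean_space
begin

definition "inner x y = (\<Sum>A\<in>UNIV. mcoeff x A * mcoeff y A)"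
definition "norm (x :: 'a multicomplex) = sqrt (inner x x)"
definition "sgn (x :: 'a multicomplex) = x /\<^sub>R norm x"
definition "dist (x :: 'a multicomplex) y = norm (x - y)"
definition "(uniformity :: ('a multicomplex \<times> 'a multicomplex) filter) =
  (INF e\<in>{0 <..}. principal {(x, y). dist x y < e})"
definition "open (U :: 'a multicomplex set) \<longleftrightarrow>
  (\<forall>x\<in>U. eventually (\<lambda>(x', y). x' = x \<longrightarrow> y \<in> U) uniformity)"
definition "Basis = (range mc_unit :: 'a multicomplex set)"

instance
proof
  fix x y z :: "'a multicomplex" and r :: real and U :: "'a multicomplex set"
  show "sgn x = x /\<^sub>R norm x" by (rule sgn_multicomplex_def)
  show "dist x y = norm (x - y)" by (rule dist_multicomplex_def)
  show "(uniformity :: ('a multicomplex \<times> 'a multicomplex) filter) =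
    (INF e\<in>{0 <..}. principal {(x, y). dist x y < e})"
    by (rule uniformity_multicomplex_def)
  show "open U \<longleftrightarrow> (\<forall>x\<in>U. eventually (\<lambda>(x', y). x' = x \<longrightarrow> y \<in> U) uniformity)"
    by (rule open_multicomplex_def)
  show "inner x y = inner y x" by (simp add: inner_multicomplex_def mult.commute)
  show "inner (x + y) z = inner x z + inner y z"
    by (simp add: inner_multicomplex_def sum.distrib algebra_simps)
  show "inner (r *\<^sub>R x) y = r * inner x y"
    by (simp add: inner_multicomplex_def sum_distrib_left mult_ac)
  show "0 \<le> inner x x" by (simp add: inner_multicomplex_def sum_nonneg)
  show "inner x x = 0 \<longleftrightarrow> x = 0"
    by (simp add: inner_multicomplex_def sum_nonneg_eq_0_iff mc_eq_iff)
  show "norm x = sqrt (inner x x)" by (rule norm_multicomplex_def)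
  show "(Basis :: 'a multicomplex set) \<noteq> {}" by (simp add: Basis_multicomplex_def)
  show "finite (Basis :: 'a multicomplex set)" by (simp add: Basis_multicomplex_def)
  have unit: "inner x (mc_unit A) = mcoeff x A" for x :: "'a multicomplex" and A
    by (simp add: inner_multicomplex_def mcoeff_unit if_distrib cong: if_cong)
  show "inner u v = (if u = v then 1 else 0)"
    if "u \<in> Basis" "v \<in> Basis" for u v :: "'a multicomplex"
    using that by (auto simp: Basis_multicomplex_def unit mcoeff_unit mc_eq_iff split: if_splits)
  show "(\<forall>u\<in>Basis. inner x u = 0) \<longleftrightarrow> x = 0"
    by (auto simp: Basis_multicomplex_def unit mc_eq_iff)
qed

end

definition mc_imag :: "'n \<Rightarrow> 'n multicomplex" where
  "mc_imag k = mc_unit {k}"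

lemma mc_imag_square: "(mc_imag k)\<^sup>2 = - 1" for k :: "'n::finite"
  by (simp add: power2_eq_square mc_imag_def mc_unit_mult one_multicomplex_def)

definition mc_basis :: "'n::finite multicomplex set" where
  "mc_basis = {\<Prod>k\<in>UNIV. mc_imag k ^ a k |a. \<forall>k. a k \<in> {0, 1 :: nat}}"

lemma mc_unit_eq_prod: "mc_unit A = (\<Prod>k\<in>A. mc_imag k)" for A :: "'n::finite set"
proof (induction A rule: finite_induct[OF finite])
  case 1
  show ?case by (simp add: one_multicomplex_def)
next
  case (2 k A)
  then have "mc_unit {k} * mc_unit A = (mc_unit (insert k A) :: 'n multicomplex)"
    using mc_unit_mult[of "{k}" A] by simp
  with 2 show ?case by (simp add: mc_imag_def)
qed

lemma mc_basis_eq: "mc_basis = (range mc_unit :: 'n::finite multicomplex set)"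
proof (intro equalityI subsetI)
  fix x :: "'n multicomplex" assume "x \<in> mc_basis"
  then obtain a :: "'n \<Rightarrow> nat" where x: "x = (\<Prod>k\<in>UNIV. mc_imag k ^ a k)" and a: "\<And>k. a k \<in> {0, 1}"
    unfolding mc_basis_def by auto
  have "(\<Prod>k\<in>UNIV. mc_imag k ^ a k) = (\<Prod>k\<in>{k. a k = 1}. mc_imag k)"
  proof (rule prod.mono_neutral_cong_right)
    show "\<forall>k\<in>UNIV - {k. a k = 1}. mc_imag k ^ a k = (1 :: 'n multicomplex)"
    proof
      fix k :: 'n
      assume "k \<in> UNIV - {k. a k = 1}"
      with a[of k] show "mc_imag k ^ a k = 1" by simp
    qed
  qed auto
  with x show "x \<in> range mc_unit" by (simp add: mc_unit_eq_prod)
next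
  fix x :: "'n multicomplex" assume "x \<in> range mc_unit"
  then obtain A where A: "x = (\<Prod>k\<in>A. mc_imag k)" by (auto simp: mc_unit_eq_prod)
  have "(\<Prod>k\<in>A. mc_imag k) = (\<Prod>k\<in>UNIV. mc_imag k ^ (if k \<in> A then 1 else 0))"
    by (intro prod.mono_neutral_cong_left) auto
  with A show "x \<in> mc_basis" unfolding mc_basis_def by (auto intro!: exI)
qed

lemma DIM_multicomplex: "DIM('n::finite multicomplex) = 2 ^ CARD('n)"
proof -
  have "inj (mc_unit :: 'n set \<Rightarrow> 'n multicomplex)"
    by (auto simp: inj_on_def mc_eq_iff mcoeff_unit split: if_splits)
  then show ?thesis by (simp add: Basis_multicomplex_def card_image card_Pow flip: Pow_UNIV)
qed


text \<open>The multicomplex numbers in the generators \<open>i\<^sub>k\<close> with \<open>k \<in> S\<close>.\<close>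

definition mc_sub :: "'n set \<Rightarrow> 'n multicomplex set" where
  "mc_sub S = {x. \<forall>A. \<not> A \<subseteq> S \<longrightarrow> mcoeff x A = 0}"

lemma mc_sub_empty: "mc_sub {} = (range of_real :: 'n::finite multicomplex set)"
proof (intro equalityI subsetI)
  fix x :: "'n multicomplex" assume "x \<in> mc_sub {}"
  then have "x = of_real (mcoeff x {})"
    by (auto simp: mc_sub_def mc_eq_iff of_real_def one_multicomplex_def mcoeff_unit)
  then show "x \<in> range of_real" by blast
qed (auto simp: mc_sub_def of_real_def one_multicomplex_def mcoeff_unit split: if_splits)

lemma mc_sub_UNIV: "mc_sub UNIV = UNIV"
  by (simp add: mc_sub_def)

lemma mcoeff_times_imag:
  "mcoeff (y * mc_imag k) C = (if k \<in> C then mcoeff y (C - {k}) else - mcoeff y (insert k C))"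
  for k :: "'n::finite"
proof -
  have "mcoeff (mc_imag k * y) C = (\<Sum>A\<in>UNIV. if A = {k} then
      (- 1) ^ card ({k} \<inter> sym_diff {k} C) * mcoeff y (sym_diff {k} C) else 0)"
    unfolding mcoeff_times mc_imag_def by (rule sum.cong) (auto simp: mcoeff_unit)
  also have "\<dots> = (- 1) ^ card ({k} \<inter> sym_diff {k} C) * mcoeff y (sym_diff {k} C)"
    by simp
  also have "\<dots> = (if k \<in> C then mcoeff y (C - {k}) else - mcoeff y (insert k C))"
    by (auto simp: insert_Diff_if)
  finally show ?thesis by (simp add: mult.commute)
qed

lemma mc_sub_insert:
  assumes "k \<notin> S"
  shows "mc_sub (insert k S) = {x + y * mc_imag k |x y. x \<in> mc_sub S \<and> y \<in> mc_sub S}"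
proof (intro equalityI subsetI)
  fix z :: "'a multicomplex" assume z: "z \<in> mc_sub (insert k S)"
  define x where "x = Multicomplex (\<lambda>A. if k \<in> A then 0 else mcoeff z A)"
  define y where "y = Multicomplex (\<lambda>A. if k \<in> A then 0 else mcoeff z (insert k A))"
  have "z = x + y * mc_imag k"
    by (rule mc_eqI) (simp add: x_def y_def mcoeff_times_imag insert_absorb)
  moreover have "x \<in> mc_sub S" "y \<in> mc_sub S"
    using z by (auto simp: mc_sub_def x_def y_def subset_insert)
  ultimately show "z \<in> {x + y * mc_imag k |x y. x \<in> mc_sub S \<and> y \<in> mc_sub S}" by blast
next
  fix z :: "'a multicomplex"
  assume "z \<in> {x + y * mc_imag k |x y. x \<in> mc_sub S \<and> y \<in> mc_sub S}"
  then obtain x y where z: "z = x + y * mc_imag k" and x: "x \<in> mc_sub S" and y: "y \<in> mc_sub S"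
    by blast
  have "mcoeff z A = 0" if A: "\<not> A \<subseteq> insert k S" for A
  proof -
    have "\<not> A \<subseteq> S" "\<not> A - {k} \<subseteq> S" "\<not> insert k A \<subseteq> S" using A assms by auto
    then show ?thesis using x y by (simp add: z mcoeff_times_imag mc_sub_def)
  qed
  then show "z \<in> mc_sub (insert k S)" by (simp add: mc_sub_def)
qed

lemma mc_sub_insert_unique:
  assumes "k \<notin> S" "x \<in> mc_sub S" "y \<in> mc_sub S" "x' \<in> mc_sub S" "y' \<in> mc_sub S"
    and eq: "x + y * mc_imag k = x' + y' * mc_imag k"
  shows "x = x' \<and> y = y'"
proof -
  have z: "mcoeff w A = 0" if "k \<in> A" "w \<in> {x, y, x', y'}" for w A
    using assms that by (auto simp: mc_sub_def)
  have c: "mcoeff (x + y * mc_imag k) A = mcoeff (x' + y' * mc_imag k) A" for A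
    using eq by simp
  have "mcoeff x A = mcoeff x' A" for A
    using c[of A] by (cases "k \<in> A") (simp_all add: z mcoeff_times_imag)
  moreover have "mcoeff y A = mcoeff y' A" for A
    using c[of "insert k A"] by (cases "k \<in> A") (simp_all add: z mcoeff_times_imag)
  ultimately show ?thesis by (simp add: mc_eq_iff)
qed


section \<open>Automorphisms\<close>

definition real_algebra_automorphism :: "('a::real_algebra_1 \<Rightarrow> 'a) \<Rightarrow> bool" where
  "real_algebra_automorphism \<psi> \<longleftrightarrow>
     linear \<psi> \<and> \<psi> 1 = 1 \<and> (\<forall>x y. \<psi> (x * y) = \<psi> x * \<psi> y) \<and> bij \<psi>"

definition basis_preserving_automorphism ::
    "('n::finite multicomplex \<Rightarrow> 'n multicomplex) \<Rightarrow> bool" where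
  "basis_preserving_automorphism \<psi> \<longleftrightarrow>
     real_algebra_automorphism \<psi> \<and> \<psi> ` mc_basis \<subseteq> mc_basis \<union> uminus ` mc_basis"


section \<open>Function classes\<close>

text \<open>
  Functions on \<open>U\<close> are represented by total functions of which only the restriction to \<open>U\<close> is
  constrained; all function classes below are used for open \<open>U\<close>.
\<close>

definition C1 :: "'a::real_normed_vector set \<Rightarrow> ('a \<Rightarrow> 'b::real_normed_vector) set" where
  "C1 U = {F. \<exists>F' :: 'a \<Rightarrow> 'a \<Rightarrow>\<^sub>L 'b.
     (\<forall>\<eta>\<in>U. (F has_derivative blinfun_apply (F' \<eta>)) (at \<eta>)) \<and> continuous_on U F'}"

abbreviation differential :: "('a::real_normed_vector \<Rightarrow> 'b::real_normed_vector) \<Rightarrow> 'a \<Rightarrow> 'a \<Rightarrow> 'b"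
  where "differential F \<eta> \<equiv> frechet_derivative F (at \<eta>)"

definition mc_L :: "'n::finite multicomplex \<Rightarrow> 'n multicomplex \<Rightarrow> 'n multicomplex" where
  "mc_L j \<eta> = j * \<eta>"

definition Hol ::
    "'n::finite multicomplex \<Rightarrow> 'n multicomplex set \<Rightarrow> ('n multicomplex \<Rightarrow> 'n multicomplex) set"
  where "Hol i U = {G \<in> C1 U. \<forall>\<eta>\<in>U. differential G \<eta> \<circ> mc_L i = mc_L i \<circ> differential G \<eta>}"

definition twisted_class ::
    "'n::finite multicomplex \<Rightarrow> 'n multicomplex \<Rightarrow> real \<Rightarrow> 'n multicomplex set \<Rightarrow>
      ('n multicomplex \<Rightarrow> 'n multicomplex) set"
  where "twisted_class i i' \<epsilon> U = {F \<in> C1 U. \<forall>\<eta>\<in>U.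
     differential F \<eta> \<circ> mc_L i = (\<lambda>v. \<epsilon> *\<^sub>R (mc_L i' \<circ> differential F \<eta>) v)}"

text \<open>
  Near every point \<open>a\<close> of \<open>U\<close>, the function is the sum of a power series in the real coordinates
  of \<open>x - a\<close>. The multi-indices are the functions \<open>\<alpha>\<close> from \<open>Basis\<close> to the natural numbers, and the
  series is summed unconditionally.
\<close>

definition real_analytic_on ::
    "('a::euclidean_space \<Rightarrow> 'b::real_normed_vector) \<Rightarrow> 'a set \<Rightarrow> bool"  (infix \<open>real'_analytic'_on\<close> 50)
  where "F real_analytic_on U \<longleftrightarrow> (\<forall>a\<in>U. \<exists>r>0. \<exists>c :: ('a \<Rightarrow> nat) \<Rightarrow> 'b. \<forall>x\<in>ball a r.
     ((\<lambda>\<alpha>. (\<Prod>b\<in>Basis. (inner (x - a) b) ^ \<alpha> b) *\<^sub>R c \<alpha>) has_sum F x) (Basis \<rightarrow>\<^sub>E UNIV))"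

end

theory Submission
  imports Defs "HOL-Complex_Analysis.Complex_Analysis"
begin

text \<open>
  The existence of \<open>\<psi>\<close> rests on the \<open>\<int>/2\<close>-grading of the algebra by the parity of the number of
  factors \<open>i\<^sub>k\<close>. A basis unit squares to \<open>-1\<close> exactly when it is odd, so \<open>i\<close> and \<open>i'\<close> are odd and
  \<open>u = - \<epsilon> i i'\<close> is an even element with \<open>u\<^sup>2 = 1\<close>. Fixing the even part and multiplying the odd
  part by \<open>u\<close> respects products, because two odd factors contribute \<open>u\<^sup>2 = 1\<close>, and it is an
  involution for the same reason. It sends \<open>i\<close> to \<open>u i = \<epsilon> i'\<close> and permutes the basis units up to
  sign (\<open>ex_basis_preserving_automorphism\<close>).

  The description of the twisted class is the chain rule: the differential of \<open>\<psi> \<circ> G\<close> is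
  \<open>\<psi> \<circ> DG\<close>, and \<open>\<psi>\<close> turns multiplication by \<open>i\<close> into multiplication by \<open>\<psi> i = \<epsilon> i'\<close>. The same
  computation with the inverse of \<open>\<psi>\<close> gives the other inclusion
  (\<open>twisted_class_eq_comp_Hol\<close>).

  Analyticity comes from several complex variables (\<open>intertwining_imp_real_analytic_on\<close>). Suppose
  that \<open>DF\<close> intertwines \<open>J\<close> with \<open>K\<close> and \<open>K\<^sup>2 = -1\<close>. Every real coordinate \<open>x\<^sub>b\<close> is replaced by a
  complex variable \<open>w\<^sub>b\<close>: the function
  \<open>w \<mapsto> F (a + (\<Sum>b. Re w\<^sub>b b + Im w\<^sub>b J b))\<close> agrees with \<open>F\<close> at real \<open>w\<close>, and it is holomorphic in
  each \<open>w\<^sub>b\<close> separately when the target carries the complex structure \<open>K\<close>. There are as many complex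
  variables as real dimensions, twice as many as a complex chart would have, but no complex
  basis has to be chosen, and a power series in \<open>w\<close> becomes the required series in the real
  coordinates as soon as \<open>w\<close> is real.

  A bounded, separately holomorphic function on a polydisc is the sum of a power series
  (\<open>bounded_separately_holomorphic_power_series\<close>). This goes by induction on the number of
  variables: the Taylor coefficients with respect to one variable are again bounded, by Cauchy's
  estimate, and they are holomorphic in the others, because each of them is a uniform limit of
  difference quotients formed from the earlier ones. The estimate bounds all coefficients of the
  multiple series by the same constant, so that it converges absolutely and may be summed
  in any order.
\<close>

section \<open>Taylor coefficients on the unit disc\<close>

definition taylor_coeff :: "(complex \<Rightarrow> complex) \<Rightarrow> nat \<Rightarrow> complex" where
  "taylor_coeff f k = (deriv ^^ k) f 0 / fact k"

lemma taylor_coeff_sums: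
  assumes "f holomorphic_on ball 0 1" and "norm z < 1"
  shows "(\<lambda>k. taylor_coeff f k * z ^ k) sums f z"
  using holomorphic_power_series[OF assms(1), of z] assms(2) by (simp add: taylor_coeff_def)

text \<open>
  Cauchy's inequality on the circle of radius \<open>r < 1\<close> gives the bound \<open>M / r ^ k\<close>; let \<open>r\<close> tend to 1.
\<close>

lemma norm_taylor_coeff_le:
  assumes hol: "f holomorphic_on ball 0 1" and bd: "\<And>z. norm z < 1 \<Longrightarrow> norm (f z) \<le> M"
  shows "norm (taylor_coeff f k) \<le> M"
proof -
  have le: "norm (taylor_coeff f k) * r ^ k \<le> M" if r: "0 < r" "r < 1" for r
  proof -
    have "norm ((deriv ^^ k) f 0) \<le> fact k * M / r ^ k"
    proof (rule Cauchy_inequality)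
      show "f holomorphic_on ball 0 r"
        using hol r by (auto intro: holomorphic_on_subset)
      show "continuous_on (cball 0 r) f"
        using hol r by (auto intro!: holomorphic_on_imp_continuous_on holomorphic_on_subset[OF hol])
    qed (use r bd in auto)
    then show ?thesis
      using r by (simp add: taylor_coeff_def norm_divide field_simps)
  qed
  have "((\<lambda>r. norm (taylor_coeff f k) * r ^ k) \<longlongrightarrow> norm (taylor_coeff f k) * 1 ^ k) (at_left 1)"
    by (intro tendsto_intros)
  moreover have "\<forall>\<^sub>F r in at_left (1::real). norm (taylor_coeff f k) * r ^ k \<le> M"
    using eventually_at_left_real[OF zero_less_one] by eventually_elim (auto intro: le)
  ultimately show ?thesis
    using tendsto_upperbound[of _ _ "at_left (1::real)" M] by fastforce
qed

text \<open>
  The bound depends on \<open>f\<close> only through \<open>M\<close>. For a family of functions with a common bound, the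
  \<open>k\<close>-th coefficient is therefore the limit of these quotients for \<open>h \<rightarrow> 0\<close>, uniformly in the
  family.
\<close>

lemma taylor_remainder_le:
  assumes hol: "f holomorphic_on ball 0 1" and bd: "\<And>z. norm z < 1 \<Longrightarrow> norm (f z) \<le> M"
    and h: "h \<noteq> 0" "norm h < 1"
  shows "norm ((f h - (\<Sum>j<k. taylor_coeff f j * h ^ j)) / h ^ k - taylor_coeff f k)
    \<le> M * norm h / (1 - norm h)"
proof -
  let ?a = "taylor_coeff f"
  have sums: "(\<lambda>n. ?a (n + Suc k) * h ^ (n + Suc k)) sums (f h - (\<Sum>j<Suc k. ?a j * h ^ j))"
    using sums_split_initial_segment[OF taylor_coeff_sums[OF hol h(2)], of "Suc k"] .
  have geo: "(\<lambda>n. M * norm h ^ Suc k * norm h ^ n) sums (M * norm h ^ Suc k * (1 / (1 - norm h)))"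
    using h by (intro sums_mult geometric_sums) auto
  have "norm (f h - (\<Sum>j<Suc k. ?a j * h ^ j)) \<le> M * norm h ^ Suc k * (1 / (1 - norm h))"
  proof (rule norm_sums_le[OF sums geo])
    fix n
    have "norm (?a (n + Suc k)) * norm h ^ (n + Suc k) \<le> M * norm h ^ (n + Suc k)"
      by (intro mult_right_mono norm_taylor_coeff_le[OF hol bd]) auto
    then show "norm (?a (n + Suc k) * h ^ (n + Suc k)) \<le> M * norm h ^ Suc k * norm h ^ n"
      by (simp add: norm_mult norm_power power_add mult_ac)
  qed
  moreover have "(f h - (\<Sum>j<k. ?a j * h ^ j)) / h ^ k - ?a k
      = (f h - (\<Sum>j<Suc k. ?a j * h ^ j)) / h ^ k"
    using h by (simp add: field_simps)
  ultimately show ?thesis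
    using h by (simp add: norm_divide norm_power divide_simps mult_ac diff_diff_eq)
qed

text \<open>
  Induction on \<open>k\<close>: the quotients in \<open>taylor_remainder_le\<close> involve \<open>f\<close> at the fixed point \<open>h\<close> and
  the earlier coefficients, hence are holomorphic in \<open>t\<close>, and their uniform limit for \<open>h \<rightarrow> 0\<close> is the
  \<open>k\<close>-th coefficient.
\<close>

lemma taylor_coeff_holomorphic_in_parameter:
  assumes hol1: "\<And>z. norm z < 1 \<Longrightarrow> (\<lambda>t. f t z) holomorphic_on ball 0 1"
    and hol2: "\<And>t. norm t < 1 \<Longrightarrow> f t holomorphic_on ball 0 1"
    and bd: "\<And>t z. norm t < 1 \<Longrightarrow> norm z < 1 \<Longrightarrow> norm (f t z) \<le> M"
  shows "(\<lambda>t. taylor_coeff (f t) k) holomorphic_on ball 0 1"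
proof (induction k rule: less_induct)
  case (less k)
  \<comment> \<open>any null sequence of nonzero points of the unit disc would do\<close>
  define h :: "nat \<Rightarrow> complex" where "h n = of_real (1 / (real n + 2))" for n
  have h: "h n \<noteq> 0" "norm (h n) < 1" for n
    by (simp_all add: h_def norm_divide add_eq_0_iff flip: of_real_add)
  define q where "q n t = (f t (h n) - (\<Sum>j<k. taylor_coeff (f t) j * h n ^ j)) / h n ^ k" for n t
  have q_hol: "q n holomorphic_on ball 0 1" for n
    unfolding q_def using h[of n] by (intro holomorphic_intros hol1 less) auto
  have err: "(\<lambda>n. M * norm (h n) / (1 - norm (h n))) \<longlonglongrightarrow> 0"
  proof -
    have "(\<lambda>n. norm (h n)) \<longlonglongrightarrow> 0"
      unfolding h_def norm_of_real by real_asymp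
    then have "(\<lambda>n. M * norm (h n) / (1 - norm (h n))) \<longlonglongrightarrow> M * 0 / (1 - 0)"
      by (intro tendsto_intros) auto
    then show ?thesis by simp
  qed
  have lim: "uniform_limit (ball 0 1) q (\<lambda>t. taylor_coeff (f t) k) sequentially"
  proof (rule uniform_limitI)
    fix e :: real
    assume "e > 0"
    with err have "\<forall>\<^sub>F n in sequentially. M * norm (h n) / (1 - norm (h n)) < e"
      by (rule order_tendstoD)
    then show "\<forall>\<^sub>F n in sequentially. \<forall>t\<in>ball 0 1. dist (q n t) (taylor_coeff (f t) k) < e"
    proof eventually_elim
      case (elim n)
      show ?case
      proof
        fix t :: complex
        assume "t \<in> ball 0 1"
        then have t: "norm t < 1" by simp
        from taylor_remainder_le[OF hol2[OF t] bd[OF t] h, of n k] elim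
        show "dist (q n t) (taylor_coeff (f t) k) < e"
          by (simp add: q_def dist_norm)
      qed
    qed
  qed
  show ?case
  proof (rule holomorphic_uniform_sequence[OF open_ball q_hol])
    fix t :: complex
    assume "t \<in> ball 0 1"
    then obtain d where "d > 0" "cball t d \<subseteq> ball 0 1"
      using open_contains_cball open_ball by metis
    then show "\<exists>d>0. cball t d \<subseteq> ball 0 1 \<and>
        uniform_limit (cball t d) q (\<lambda>t. taylor_coeff (f t) k) sequentially"
      using uniform_limit_on_subset[OF lim] by blast
  qed
qed

section \<open>Power series in several complex variables\<close>

text \<open>
  A product of geometric series; it dominates every power series with bounded coefficients.
\<close>

lemma summable_on_monomials:
  fixes r :: "'a \<Rightarrow> real"
  assumes "finite S" and "\<And>b. b \<in> S \<Longrightarrow> 0 \<le> r b \<and> r b < 1"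
  shows "(\<lambda>\<alpha>. \<Prod>b\<in>S. r b ^ \<alpha> b) summable_on (S \<rightarrow>\<^sub>E (UNIV :: nat set))"
  using assms
proof (induction S rule: finite_induct)
  case empty
  show ?case by simp
next
  case (insert s S)
  let ?P = "\<lambda>\<alpha>. \<Prod>b\<in>S. r b ^ \<alpha> b"
  have sum: "?P summable_on (S \<rightarrow>\<^sub>E (UNIV :: nat set))"
    using insert by auto
  have geo: "(\<lambda>k. r s ^ k) summable_on UNIV"
    using insert.prems[of s] by (intro norm_summable_imp_summable_on) (simp add: norm_power)
  have "(\<lambda>(k, \<alpha>). r s ^ k * ?P \<alpha>) summable_on (UNIV \<times> (S \<rightarrow>\<^sub>E (UNIV :: nat set)))"
  proof (rule summable_on_SigmaI)
    show "((\<lambda>\<alpha>. case (k, \<alpha>) of (k, \<alpha>) \<Rightarrow> r s ^ k * ?P \<alpha>) has_sum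
        r s ^ k * infsum ?P (S \<rightarrow>\<^sub>E UNIV)) (S \<rightarrow>\<^sub>E (UNIV :: nat set))" for k
      using has_sum_cmult_right[OF has_sum_infsum[OF sum]] by simp
    show "(\<lambda>k. r s ^ k * infsum ?P (S \<rightarrow>\<^sub>E UNIV)) summable_on UNIV"
      using geo by (rule summable_on_cmult_left)
  qed (use insert.prems in \<open>auto intro!: mult_nonneg_nonneg prod_nonneg\<close>)
  moreover have "(\<lambda>(k, \<alpha>). r s ^ k * ?P \<alpha>) =
      (\<lambda>\<alpha>. \<Prod>b\<in>insert s S. r b ^ \<alpha> b) \<circ> (\<lambda>(k, \<alpha>). \<alpha>(s := k))"
  proof (intro ext, clarify)
    fix k :: nat and \<alpha> :: "'a \<Rightarrow> nat"
    have "(\<Prod>b\<in>S. r b ^ (\<alpha>(s := k)) b) = ?P \<alpha>"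
      using insert.hyps by (intro prod.cong) auto
    then show "r s ^ k * ?P \<alpha> =
        ((\<lambda>\<alpha>. \<Prod>b\<in>insert s S. r b ^ \<alpha> b) \<circ> (\<lambda>(k, \<alpha>). \<alpha>(s := k))) (k, \<alpha>)"
      using insert.hyps by simp
  qed
  ultimately show ?case
    unfolding PiE_insert_eq
    by (subst summable_on_reindex[OF inj_combinator]) (use insert.hyps in simp_all)
qed

text \<open>
  Expand \<open>g\<close> in one variable; by \<open>taylor_coeff_holomorphic_in_parameter\<close> and
  \<open>norm_taylor_coeff_le\<close> the coefficients satisfy the same hypotheses in the remaining variables,
  with the same bound \<open>M\<close>. This uniform bound is part of the conclusion since it makes the
  double series over the exponent of the new variable and the remaining exponents converge
  absolutely. Points and multi-indices are extensional functions on \<open>S\<close>, so that \<open>g\<close> depends on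
  no coordinates outside \<open>S\<close>.
\<close>

theorem bounded_separately_holomorphic_power_series:
  fixes g :: "('a \<Rightarrow> complex) \<Rightarrow> complex"
  assumes "finite S"
    and "\<And>s w. s \<in> S \<Longrightarrow> w \<in> S \<rightarrow>\<^sub>E ball 0 1 \<Longrightarrow> (\<lambda>z. g (w(s := z))) holomorphic_on ball 0 1"
    and "\<And>w. w \<in> S \<rightarrow>\<^sub>E ball 0 1 \<Longrightarrow> norm (g w) \<le> M"
  shows "\<exists>c :: ('a \<Rightarrow> nat) \<Rightarrow> complex. (\<forall>\<alpha>\<in>S \<rightarrow>\<^sub>E UNIV. norm (c \<alpha>) \<le> M) \<and>
    (\<forall>w\<in>S \<rightarrow>\<^sub>E ball 0 1. ((\<lambda>\<alpha>. (\<Prod>b\<in>S. w b ^ \<alpha> b) * c \<alpha>) has_sum g w) (S \<rightarrow>\<^sub>E UNIV))"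
  using assms
proof (induction S arbitrary: g rule: finite_induct)
  case empty
  have "((\<lambda>\<alpha>. (\<Prod>b\<in>{}. w b ^ \<alpha> b) * g (\<lambda>_. undefined)) has_sum g w) ({} \<rightarrow>\<^sub>E (UNIV :: nat set))"
    if "w \<in> {} \<rightarrow>\<^sub>E ball 0 1" for w
    using that by (auto intro!: has_sum_finiteI)
  with empty show ?case
    by (intro exI[of _ "\<lambda>_. g (\<lambda>_. undefined)"]) auto
next
  case (insert s S)
  \<comment> \<open>from here on, a point is split into its coordinate \<open>z\<close> at \<open>s\<close> and the remaining coordinates \<open>v\<close>\<close>
  have upd: "v(s := z) \<in> insert s S \<rightarrow>\<^sub>E ball 0 1" if "v \<in> S \<rightarrow>\<^sub>E ball 0 1" "norm z < 1" for v z
    using that by (auto simp: PiE_insert_eq intro!: image_eqI[where x = "(z, v)"])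
  have holo: "(\<lambda>z. g (v(s := z))) holomorphic_on ball 0 1" if v: "v \<in> S \<rightarrow>\<^sub>E ball 0 1" for v
  proof -
    have "norm (0::complex) < 1" by simp
    from insert.prems(1)[OF insertI1 upd[OF v this]] show ?thesis by (simp only: fun_upd_upd)
  qed
  have bd: "norm (g (v(s := z))) \<le> M" if "v \<in> S \<rightarrow>\<^sub>E ball 0 1" "norm z < 1" for v z
    by (rule insert.prems(2)[OF upd[OF that]])
  define a where "a k v = taylor_coeff (\<lambda>z. g (v(s := z))) k" for k v
  have "\<exists>c. (\<forall>\<alpha>\<in>S \<rightarrow>\<^sub>E UNIV. norm (c \<alpha>) \<le> M) \<and>
      (\<forall>w\<in>S \<rightarrow>\<^sub>E ball 0 1. ((\<lambda>\<alpha>. (\<Prod>b\<in>S. w b ^ \<alpha> b) * c \<alpha>) has_sum a k w) (S \<rightarrow>\<^sub>E (UNIV :: nat set)))"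
    for k
  proof (rule insert.IH)
    fix t v assume t: "t \<in> S" and v: "v \<in> S \<rightarrow>\<^sub>E ball (0::complex) 1"
    then have st: "s \<noteq> t" using insert.hyps by auto
    have vt: "v(t := x) \<in> S \<rightarrow>\<^sub>E ball 0 1" if "norm x < 1" for x
      using v t that by (auto simp: PiE_iff extensional_def)
    show "(\<lambda>x. a k (v(t := x))) holomorphic_on ball 0 1"
      unfolding a_def
    proof (rule taylor_coeff_holomorphic_in_parameter)
      fix z :: complex assume "norm z < 1"
      from insert.prems(1)[OF insertI2[OF t] upd[OF v this]]
      show "(\<lambda>x. g (v(t := x, s := z))) holomorphic_on ball 0 1"
        by (simp only: fun_upd_twist[OF st])
    qed (use holo[OF vt] bd[OF vt] in auto)
  next
    fix v assume v: "v \<in> S \<rightarrow>\<^sub>E ball (0::complex) 1"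
    show "norm (a k v) \<le> M"
      unfolding a_def by (rule norm_taylor_coeff_le[OF holo[OF v] bd[OF v]])
  qed
  then have "\<exists>c. \<forall>k. (\<forall>\<alpha>\<in>S \<rightarrow>\<^sub>E UNIV. norm (c k \<alpha>) \<le> M) \<and>
      (\<forall>w\<in>S \<rightarrow>\<^sub>E ball 0 1. ((\<lambda>\<alpha>. (\<Prod>b\<in>S. w b ^ \<alpha> b) * c k \<alpha>) has_sum a k w) (S \<rightarrow>\<^sub>E (UNIV :: nat set)))"
    by (intro choice allI)
  then obtain c where c_le: "\<And>k \<alpha>. \<alpha> \<in> S \<rightarrow>\<^sub>E UNIV \<Longrightarrow> norm (c k \<alpha>) \<le> M"
    and c_sum: "\<And>k v. v \<in> S \<rightarrow>\<^sub>E ball 0 1 \<Longrightarrow>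
      ((\<lambda>\<alpha>. (\<Prod>b\<in>S. v b ^ \<alpha> b) * c k \<alpha>) has_sum a k v) (S \<rightarrow>\<^sub>E (UNIV :: nat set))"
    by blast
  \<comment> \<open>the exponent at \<open>s\<close> selects the series; \<open>undefined\<close> restores an extensional function on \<open>S\<close>\<close>
  define C where "C \<alpha> = c (\<alpha> s) (\<alpha>(s := undefined))" for \<alpha> :: "'a \<Rightarrow> nat"
  have C_upd: "C (\<alpha>(s := k)) = c k \<alpha>" if "\<alpha> \<in> S \<rightarrow>\<^sub>E UNIV" for \<alpha> k
  proof -
    have "\<alpha>(s := undefined) = \<alpha>"
      using that insert.hyps by (auto simp: PiE_iff extensional_def fun_eq_iff)
    then show ?thesis by (simp add: C_def)
  qed
  have C_le: "norm (C \<alpha>) \<le> M" if "\<alpha> \<in> insert s S \<rightarrow>\<^sub>E UNIV" for \<alpha>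
    using that c_le by (auto simp: PiE_insert_eq C_upd)
  have "((\<lambda>\<alpha>. (\<Prod>b\<in>insert s S. w b ^ \<alpha> b) * C \<alpha>) has_sum g w) (insert s S \<rightarrow>\<^sub>E UNIV)"
    if w: "w \<in> insert s S \<rightarrow>\<^sub>E ball 0 1" for w
  proof -
    let ?T = "\<lambda>\<alpha>. (\<Prod>b\<in>insert s S. w b ^ \<alpha> b) * C \<alpha>"
    from w obtain v z where v: "v \<in> S \<rightarrow>\<^sub>E ball 0 1" and z: "norm z < 1" and wvz: "w = v(s := z)"
      by (auto simp: PiE_insert_eq)
    have "(\<lambda>\<alpha>. norm (?T \<alpha>)) summable_on (insert s S \<rightarrow>\<^sub>E UNIV)"
    proof (rule summable_on_comparison_test)
      show "(\<lambda>\<alpha>. (\<Prod>b\<in>insert s S. norm (w b) ^ \<alpha> b) * M) summable_on (insert s S \<rightarrow>\<^sub>E UNIV)"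
        using w insert.hyps
        by (intro summable_on_cmult_left summable_on_monomials) (auto simp: PiE_iff)
      show "norm (?T \<alpha>) \<le> (\<Prod>b\<in>insert s S. norm (w b) ^ \<alpha> b) * M"
        if "\<alpha> \<in> insert s S \<rightarrow>\<^sub>E UNIV" for \<alpha>
        unfolding norm_mult prod_norm[symmetric] norm_power
        by (intro mult_left_mono C_le that prod_nonneg) auto
    qed auto
    then have "?T summable_on (insert s S \<rightarrow>\<^sub>E UNIV)"
      by (rule abs_summable_summable)
    then have summ: "(?T \<circ> (\<lambda>(k, \<alpha>). \<alpha>(s := k))) summable_on (UNIV \<times> (S \<rightarrow>\<^sub>E UNIV))"
      unfolding PiE_insert_eq
      by (subst (asm) summable_on_reindex[OF inj_combinator]) (use insert.hyps in auto)
    have T_upd: "?T (\<alpha>(s := k)) = z ^ k * ((\<Prod>b\<in>S. v b ^ \<alpha> b) * c k \<alpha>)"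
      if "\<alpha> \<in> S \<rightarrow>\<^sub>E UNIV" for k \<alpha>
    proof -
      have "(\<Prod>b\<in>S. w b ^ (\<alpha>(s := k)) b) = (\<Prod>b\<in>S. v b ^ \<alpha> b)"
        using insert.hyps by (intro prod.cong) (auto simp: wvz)
      then show ?thesis
        using insert.hyps that by (simp add: wvz C_upd mult_ac)
    qed
    have "((?T \<circ> (\<lambda>(k, \<alpha>). \<alpha>(s := k))) has_sum g w) (UNIV \<times> (S \<rightarrow>\<^sub>E UNIV))"
    proof (rule has_sum_SigmaI[OF _ _ summ])
      fix k :: nat
      have sum: "((\<lambda>\<alpha>. z ^ k * ((\<Prod>b\<in>S. v b ^ \<alpha> b) * c k \<alpha>)) has_sum z ^ k * a k v) (S \<rightarrow>\<^sub>E UNIV)"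
        by (intro has_sum_cmult_right c_sum v)
      have eq: "(?T \<circ> (\<lambda>(k, \<alpha>). \<alpha>(s := k))) (k, \<alpha>) = z ^ k * ((\<Prod>b\<in>S. v b ^ \<alpha> b) * c k \<alpha>)"
        if "\<alpha> \<in> S \<rightarrow>\<^sub>E UNIV" for \<alpha>
        unfolding o_apply prod.case by (rule T_upd[OF that])
      show "((\<lambda>\<alpha>. (?T \<circ> (\<lambda>(k, \<alpha>). \<alpha>(s := k))) (k, \<alpha>)) has_sum z ^ k * a k v) (S \<rightarrow>\<^sub>E UNIV)"
        by (rule iffD2[OF has_sum_cong sum]) (rule eq)
    next
      have sums: "(\<lambda>k. z ^ k * a k v) sums g w"
        using taylor_coeff_sums[OF holo[OF v] z] by (simp add: a_def wvz mult.commute)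
      have "summable (\<lambda>k. norm z ^ k * M)"
        using z by (intro summable_mult2 summable_geometric) auto
      then have "summable (\<lambda>k. norm (z ^ k * a k v))"
        by (rule summable_comparison_test')
           (auto simp: norm_mult norm_power a_def
             intro!: mult_left_mono norm_taylor_coeff_le[OF holo[OF v] bd[OF v]])
      then show "((\<lambda>k. z ^ k * a k v) has_sum g w) UNIV"
        using sums by (rule norm_summable_imp_has_sum)
    qed
    then show ?thesis
      unfolding PiE_insert_eq
      by (subst has_sum_reindex[OF inj_combinator]) (use insert.hyps in auto)
  qed
  with C_le show ?case by blast
qed

section \<open>Maps whose differential intertwines two linear maps\<close>

text \<open>
  Along the real plane through \<open>p\<close> in the directions \<open>u\<close> and \<open>v\<close>, moving in the direction \<open>v\<close> has
  the effect of applying \<open>K\<close> to the derivative in the direction \<open>u\<close>. The functional \<open>h\<close> turns \<open>K\<close>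
  into multiplication by \<open>\<i>\<close>, and this is the Cauchy-Riemann equation.
\<close>

lemma intertwining_imp_complex_differentiable:
  fixes F :: "'a::real_normed_vector \<Rightarrow> 'b::real_normed_vector" and h :: "'b \<Rightarrow> complex"
  assumes F: "(F has_derivative F') (at (p + Re z *\<^sub>R u + Im z *\<^sub>R v))"
    and F': "F' v = K (F' u)"
    and h: "bounded_linear h" and hK: "\<And>y. h (K y) = \<i> * h y"
  shows "((\<lambda>z. h (F (p + Re z *\<^sub>R u + Im z *\<^sub>R v))) has_field_derivative h (F' u)) (at z)"
proof -
  interpret F': bounded_linear F' using F by (rule has_derivative_bounded_linear)
  interpret h: bounded_linear h by (rule h)
  have "((\<lambda>z. p + Re z *\<^sub>R u + Im z *\<^sub>R v) has_derivative (\<lambda>t. Re t *\<^sub>R u + Im t *\<^sub>R v)) (at z)"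
    by (auto intro!: derivative_eq_intros)
  from has_derivative_compose[OF this F]
  have "((\<lambda>z. h (F (p + Re z *\<^sub>R u + Im z *\<^sub>R v))) has_derivative
      (\<lambda>t. h (F' (Re t *\<^sub>R u + Im t *\<^sub>R v)))) (at z)"
    by (rule bounded_linear.has_derivative[OF h])
  moreover have "h (F' (Re t *\<^sub>R u + Im t *\<^sub>R v)) = h (F' u) * t" for t
    by (simp add: F'.add F'.scaleR h.add h.scaleR F' hK scaleR_conv_of_real complex_eq_iff)
  ultimately show ?thesis
    by (simp add: has_field_derivative_def)
qed

lemma has_sum_finite_sum:
  fixes f :: "'i \<Rightarrow> 'a \<Rightarrow> 'b::topological_comm_monoid_add"
  assumes "\<And>d. d \<in> D \<Longrightarrow> (f d has_sum s d) A"
  shows "((\<lambda>x. \<Sum>d\<in>D. f d x) has_sum (\<Sum>d\<in>D. s d)) A"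
  using assms by (induction D rule: infinite_finite_induct) (auto intro: has_sum_add)

text \<open>
  Complexify the real coordinates as explained at the beginning. The target is treated one real
  coordinate \<open>d\<close> at a time: \<open>h y = y\<^sub>d - \<i> (K y)\<^sub>d\<close> is complex linear for the structure \<open>K\<close>
  and has \<open>y\<^sub>d\<close> as its real part, so the series for \<open>y\<^sub>d\<close> has the real parts of the complex
  coefficients.
\<close>

theorem intertwining_imp_real_analytic_on:
  fixes F :: "'a::euclidean_space \<Rightarrow> 'b::euclidean_space"
  assumes U: "open U"
    and F: "\<And>\<eta>. \<eta> \<in> U \<Longrightarrow> (F has_derivative F' \<eta>) (at \<eta>)"
    and F': "\<And>\<eta> v. \<eta> \<in> U \<Longrightarrow> F' \<eta> (J v) = K (F' \<eta> v)"
    and K: "linear K" "\<And>y. K (K y) = - y"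
  shows "F real_analytic_on U"
  unfolding real_analytic_on_def
proof
  fix a assume "a \<in> U"
  with U obtain e where e: "e > 0" "cball a e \<subseteq> U"
    using open_contains_cball by blast
  have "continuous_on (cball a e) F"
    using F e(2) by (intro continuous_at_imp_continuous_on) (meson has_derivative_continuous subsetD)
  then have "bounded (F ` cball a e)"
    by (intro compact_imp_bounded compact_continuous_image) auto
  then obtain M where M: "\<And>\<eta>. \<eta> \<in> cball a e \<Longrightarrow> norm (F \<eta>) \<le> M"
    unfolding bounded_iff by blast
  \<comment> \<open>chosen so that the closed unit polydisc is mapped into \<open>cball a e\<close> by \<open>L\<close> below\<close>
  define \<rho> where "\<rho> = e / (\<Sum>b\<in>(Basis :: 'a set). 1 + norm (J b))"
  have sum_pos: "(\<Sum>b\<in>(Basis :: 'a set). 1 + norm (J b)) > 0"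
    by (intro sum_pos) (auto simp: add_pos_nonneg)
  then have \<rho>: "\<rho> > 0" "\<rho> * (\<Sum>b\<in>(Basis :: 'a set). 1 + norm (J b)) = e"
    using e(1) by (auto simp: \<rho>_def)
  define L where "L w = a + (\<Sum>b\<in>Basis. Re (w b) *\<^sub>R \<rho> *\<^sub>R b + Im (w b) *\<^sub>R \<rho> *\<^sub>R J b)"
    for w :: "'a \<Rightarrow> complex"
  have L_in: "L w \<in> cball a e" if w: "w \<in> Basis \<rightarrow>\<^sub>E ball 0 1" for w
  proof -
    have le: "norm (Re (w b) *\<^sub>R \<rho> *\<^sub>R b + Im (w b) *\<^sub>R \<rho> *\<^sub>R J b) \<le> \<rho> * (1 + norm (J b))"
      if b: "b \<in> Basis" for b
    proof -
      have "norm (w b) < 1" using w b by (auto simp: PiE_iff)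
      then have "\<bar>Re (w b)\<bar> \<le> 1" "\<bar>Im (w b)\<bar> \<le> 1"
        using abs_Re_le_cmod[of "w b"] abs_Im_le_cmod[of "w b"] by linarith+
      then have "\<bar>Re (w b)\<bar> * \<rho> \<le> 1 * \<rho>" "\<bar>Im (w b)\<bar> * (\<rho> * norm (J b)) \<le> 1 * (\<rho> * norm (J b))"
        using \<rho>(1) by (intro mult_right_mono; simp)+
      moreover have "norm (Re (w b) *\<^sub>R \<rho> *\<^sub>R b + Im (w b) *\<^sub>R \<rho> *\<^sub>R J b)
          \<le> \<bar>Re (w b)\<bar> * \<rho> + \<bar>Im (w b)\<bar> * (\<rho> * norm (J b))"
        using b \<rho>(1) by (intro order_trans[OF norm_triangle_ineq]) (simp add: abs_mult)
      ultimately show ?thesis by (simp add: algebra_simps)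
    qed
    have "norm (L w - a) \<le> (\<Sum>b\<in>Basis. \<rho> * (1 + norm (J b)))"
      unfolding L_def add_diff_cancel_left' by (intro sum_norm_le le)
    then show ?thesis
      using \<rho>(2) by (simp add: dist_norm norm_minus_commute sum_distrib_left)
  qed
  have "\<exists>c :: ('a \<Rightarrow> nat) \<Rightarrow> real. \<forall>x\<in>ball a \<rho>.
      ((\<lambda>\<alpha>. (\<Prod>b\<in>Basis. inner (x - a) b ^ \<alpha> b) * c \<alpha>) has_sum inner (F x) d) (Basis \<rightarrow>\<^sub>E UNIV)"
    for d
  proof -
    define h where "h y = of_real (inner y d) - \<i> * of_real (inner (K y) d)" for y
    have h: "bounded_linear h"
      unfolding h_def linear_conv_bounded_linear[symmetric]
      by (auto intro!: linearI simp: linear_add[OF K(1)] linear_scale[OF K(1)]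
          inner_add_left algebra_simps scaleR_conv_of_real)
    have hK: "h (K y) = \<i> * h y" for y
      by (simp add: h_def K(2) algebra_simps)
    have hol: "(\<lambda>z. h (F (L (w(s := z))))) holomorphic_on ball 0 1"
      if s: "s \<in> Basis" and w: "w \<in> Basis \<rightarrow>\<^sub>E ball 0 1" for s w
    proof -
      define p where "p = a + (\<Sum>b\<in>Basis - {s}. Re (w b) *\<^sub>R \<rho> *\<^sub>R b + Im (w b) *\<^sub>R \<rho> *\<^sub>R J b)"
      have L_upd: "L (w(s := z)) = p + Re z *\<^sub>R \<rho> *\<^sub>R s + Im z *\<^sub>R \<rho> *\<^sub>R J s" for z
        unfolding L_def p_def sum.remove[OF finite_Basis s] by (simp add: algebra_simps)
      have "\<exists>D. ((\<lambda>z. h (F (L (w(s := z))))) has_field_derivative D) (at z)" if z: "norm z < 1" for z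
      proof -
        have "w(s := z) \<in> Basis \<rightarrow>\<^sub>E ball 0 1"
          using w s z by (auto simp: PiE_iff extensional_def)
        then have "L (w(s := z)) \<in> U"
          using L_in e(2) by blast
        note D = F[OF this] F'[OF this]
        interpret D: bounded_linear "F' (L (w(s := z)))"
          using D(1) by (rule has_derivative_bounded_linear)
        have "F' (L (w(s := z))) (\<rho> *\<^sub>R J s) = K (F' (L (w(s := z))) (\<rho> *\<^sub>R s))"
          by (simp add: D.scaleR D(2) linear_scale[OF K(1)])
        from intertwining_imp_complex_differentiable[OF D(1)[unfolded L_upd] this[unfolded L_upd] h hK]
        show ?thesis unfolding L_upd by blast
      qed
      then show ?thesis
        by (simp add: holomorphic_on_open field_differentiable_def)
    qed
    obtain B where B: "\<And>y. norm (h y) \<le> norm y * B" "B > 0"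
      using bounded_linear.pos_bounded[OF h] by blast
    have bd: "norm (h (F (L w))) \<le> M * B" if "w \<in> Basis \<rightarrow>\<^sub>E ball 0 1" for w
      using M[OF L_in[OF that]] B(1)[of "F (L w)"] B(2)
      by (meson mult_right_mono order_less_imp_le order_trans)
    from bounded_separately_holomorphic_power_series[OF finite_Basis hol bd]
    obtain c :: "('a \<Rightarrow> nat) \<Rightarrow> complex" where c: "\<And>w. w \<in> Basis \<rightarrow>\<^sub>E ball 0 1 \<Longrightarrow>
        ((\<lambda>\<alpha>. (\<Prod>b\<in>Basis. w b ^ \<alpha> b) * c \<alpha>) has_sum h (F (L w))) (Basis \<rightarrow>\<^sub>E UNIV)"
      by blast
    show ?thesis
    proof (intro exI ballI)
      fix x assume x: "x \<in> ball a \<rho>"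
      \<comment> \<open>the real point of the polydisc that \<open>L\<close> sends to \<open>x\<close>\<close>
      define w where "w = (\<lambda>b\<in>Basis. complex_of_real (inner (x - a) b / \<rho>))"
      have w: "w \<in> Basis \<rightarrow>\<^sub>E ball 0 1"
      proof (rule PiE_I)
        fix b :: 'a assume b: "b \<in> Basis"
        have "\<bar>inner (x - a) b\<bar> \<le> norm (x - a)" by (rule Basis_le_norm[OF b])
        also have "\<dots> < \<rho>" using x by (simp add: dist_norm norm_minus_commute)
        finally show "w b \<in> ball 0 1"
          using b \<rho>(1) by (simp add: w_def norm_divide del: of_real_divide)
      qed (simp add: w_def)
      have "L w = a + (\<Sum>b\<in>Basis. inner (x - a) b *\<^sub>R b)"
        unfolding L_def using \<rho>(1) by (simp add: w_def)
      then have Lw: "L w = x" by (simp only: euclidean_representation) simp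
      have eq: "Re ((\<Prod>b\<in>Basis. w b ^ \<alpha> b) * c \<alpha>) =
          (\<Prod>b\<in>Basis. inner (x - a) b ^ \<alpha> b) * (Re (c \<alpha>) / (\<Prod>b\<in>(Basis :: 'a set). \<rho> ^ \<alpha> b))" for \<alpha>
      proof -
        have "(\<Prod>b\<in>Basis. w b ^ \<alpha> b) = of_real (\<Prod>b\<in>Basis. (inner (x - a) b / \<rho>) ^ \<alpha> b)"
          unfolding of_real_prod by (intro prod.cong) (simp_all add: w_def)
        then have "Re ((\<Prod>b\<in>Basis. w b ^ \<alpha> b) * c \<alpha>) =
            (\<Prod>b\<in>Basis. (inner (x - a) b / \<rho>) ^ \<alpha> b) * Re (c \<alpha>)"
          by (simp only: Re_complex_of_real Im_complex_of_real times_complex.sel)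
        then show ?thesis by (simp add: power_divide prod_dividef)
      qed
      have "Re (h (F x)) = inner (F x) d" by (simp add: h_def)
      with has_sum_Re[OF c[OF w]]
      show "((\<lambda>\<alpha>. (\<Prod>b\<in>Basis. inner (x - a) b ^ \<alpha> b) *
          (Re (c \<alpha>) / (\<Prod>b\<in>(Basis :: 'a set). \<rho> ^ \<alpha> b))) has_sum inner (F x) d) (Basis \<rightarrow>\<^sub>E UNIV)"
        by (simp only: eq Lw)
    qed
  qed
  then have "\<exists>c :: 'b \<Rightarrow> ('a \<Rightarrow> nat) \<Rightarrow> real. \<forall>d. \<forall>x\<in>ball a \<rho>.
      ((\<lambda>\<alpha>. (\<Prod>b\<in>Basis. inner (x - a) b ^ \<alpha> b) * c d \<alpha>) has_sum inner (F x) d) (Basis \<rightarrow>\<^sub>E UNIV)"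
    by (intro choice allI)
  then obtain c :: "'b \<Rightarrow> ('a \<Rightarrow> nat) \<Rightarrow> real" where c: "\<And>d x. x \<in> ball a \<rho> \<Longrightarrow>
      ((\<lambda>\<alpha>. (\<Prod>b\<in>Basis. inner (x - a) b ^ \<alpha> b) * c d \<alpha>) has_sum inner (F x) d) (Basis \<rightarrow>\<^sub>E UNIV)"
    by blast
  have "((\<lambda>\<alpha>. (\<Prod>b\<in>Basis. inner (x - a) b ^ \<alpha> b) *\<^sub>R (\<Sum>d\<in>Basis. c d \<alpha> *\<^sub>R d)) has_sum F x)
      (Basis \<rightarrow>\<^sub>E UNIV)" if x: "x \<in> ball a \<rho>" for x
  proof -
    have "((\<lambda>\<alpha>. \<Sum>d\<in>Basis. ((\<Prod>b\<in>Basis. inner (x - a) b ^ \<alpha> b) * c d \<alpha>) *\<^sub>R d) has_sum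
        (\<Sum>d\<in>Basis. inner (F x) d *\<^sub>R d)) (Basis \<rightarrow>\<^sub>E UNIV)"
      by (intro has_sum_finite_sum has_sum_bounded_linear[OF bounded_linear_scaleR_left c[OF x]])
    then show ?thesis
      by (simp only: euclidean_representation scaleR_sum_right scaleR_scaleR)
  qed
  with \<rho>(1) show "\<exists>r>0. \<exists>c :: ('a \<Rightarrow> nat) \<Rightarrow> 'b. \<forall>x\<in>ball a r.
      ((\<lambda>\<alpha>. (\<Prod>b\<in>Basis. inner (x - a) b ^ \<alpha> b) *\<^sub>R c \<alpha>) has_sum F x) (Basis \<rightarrow>\<^sub>E UNIV)"
    by (intro exI[of _ \<rho>] exI[of _ "\<lambda>\<alpha>. \<Sum>d\<in>Basis. c d \<alpha> *\<^sub>R d"] conjI ballI)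
qed

section \<open>An automorphism with prescribed image of an imaginary unit\<close>

lemma real_algebra_automorphismI_involution:
  assumes "linear \<psi>" "\<psi> 1 = 1" "\<And>x y. \<psi> (x * y) = \<psi> x * \<psi> y" "\<And>x. \<psi> (\<psi> x) = x"
  shows "real_algebra_automorphism \<psi>"
  using assms unfolding real_algebra_automorphism_def by (auto intro!: o_bij[of \<psi>])

text \<open>
  The algebra is graded by the eigenspaces of an involutive automorphism \<open>\<phi>\<close>. The part of \<open>x\<close> with
  eigenvalue 1 is fixed, the part with eigenvalue -1 is multiplied by \<open>u\<close>.
\<close>

definition grading_twist :: "('a \<Rightarrow> 'a) \<Rightarrow> 'a \<Rightarrow> 'a \<Rightarrow> 'a::{comm_ring_1,real_algebra_1}" where
  "grading_twist \<phi> u x = (1 / 2) *\<^sub>R ((x + \<phi> x) + u * (x - \<phi> x))"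

lemma grading_twist_even: "grading_twist \<phi> u x = x" if "\<phi> x = x"
  by (simp only: grading_twist_def that diff_self mult_zero_right add_0_right scaleR_half_double)

lemma grading_twist_odd: "grading_twist \<phi> u x = u * x" if "\<phi> x = - x"
  by (simp only: grading_twist_def that diff_minus_eq_add add.right_inverse add_0_left
      distrib_left scaleR_half_double)

lemma half_sum_add_half_diff: "(1 / 2) *\<^sub>R (e + d) + (1 / 2) *\<^sub>R (e - d) = e" for e :: "'a::real_vector"
  by (simp flip: scaleR_add_right)

lemma half_sum_diff_half_diff: "(1 / 2) *\<^sub>R (e + d) - (1 / 2) *\<^sub>R (e - d) = d" for e :: "'a::real_vector"
  by (simp flip: scaleR_diff_right)

text \<open>
  Write \<open>e\<close> and \<open>d\<close> for the parts with eigenvalue 1 and -1. Since \<open>u\<close> is even,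
  \<open>(e + u d) (e' + u d') = (e e' + u\<^sup>2 d d') + u (e d' + d e')\<close> is the twist of the product if
  \<open>u\<^sup>2 = 1\<close>. As \<open>u d\<close> is odd, twisting again multiplies it by \<open>u\<close> and gives back \<open>d\<close>.
\<close>

lemma grading_twist_automorphism:
  fixes \<phi> :: "'a::{comm_ring_1,real_algebra_1} \<Rightarrow> 'a"
  assumes lin: "linear \<phi>" and one: "\<phi> 1 = 1" and mult: "\<And>x y. \<phi> (x * y) = \<phi> x * \<phi> y"
    and inv: "\<And>x. \<phi> (\<phi> x) = x" and u: "u * u = 1" "\<phi> u = u"
  shows "real_algebra_automorphism (grading_twist \<phi> u)"
proof (rule real_algebra_automorphismI_involution)
  show "linear (grading_twist \<phi> u)"
    by (rule linearI)
      (simp_all add: grading_twist_def linear_add[OF lin] linear_scale[OF lin] algebra_simps)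
  show "grading_twist \<phi> u 1 = 1"
    by (simp only: one grading_twist_even)
  show "grading_twist \<phi> u (x * y) = grading_twist \<phi> u x * grading_twist \<phi> u y" for x y
  proof -
    have "((x + \<phi> x) + u * (x - \<phi> x)) * ((y + \<phi> y) + u * (y - \<phi> y)) =
        (x + \<phi> x) * (y + \<phi> y) + (u * u) * ((x - \<phi> x) * (y - \<phi> y))
        + u * ((x + \<phi> x) * (y - \<phi> y) + (x - \<phi> x) * (y + \<phi> y))"
      by (simp only: algebra_simps)
    also have "\<dots> = 2 *\<^sub>R (x * y + \<phi> (x * y) + u * (x * y - \<phi> (x * y)))"
      unfolding u(1) mult scaleR_2 by (simp only: mult_1_left algebra_simps)
    finally show ?thesis
      by (simp add: grading_twist_def)
  qed
  show "grading_twist \<phi> u (grading_twist \<phi> u x) = x" for x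
  proof -
    have phi_twist: "\<phi> (grading_twist \<phi> u x) = (1 / 2) *\<^sub>R ((x + \<phi> x) - u * (x - \<phi> x))"
      by (simp add: grading_twist_def linear_add[OF lin] linear_diff[OF lin] linear_scale[OF lin]
          mult inv u(2) algebra_simps)
    have "grading_twist \<phi> u x + \<phi> (grading_twist \<phi> u x) = x + \<phi> x"
      unfolding phi_twist unfolding grading_twist_def by (rule half_sum_add_half_diff)
    moreover have "grading_twist \<phi> u x - \<phi> (grading_twist \<phi> u x) = u * (x - \<phi> x)"
      unfolding phi_twist unfolding grading_twist_def by (rule half_sum_diff_half_diff)
    ultimately have "grading_twist \<phi> u (grading_twist \<phi> u x) = (1/2) *\<^sub>R ((x + \<phi> x) + (u * u) * (x - \<phi> x))"
      by (simp only: grading_twist_def[of \<phi> u "grading_twist \<phi> u x"] mult.assoc)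
    then show ?thesis
      by (simp only: u(1) mult_1_left scaleR_add_right[of _ "x + \<phi> x"] half_sum_add_half_diff)
  qed
qed

text \<open>
  The automorphism that sends every generator \<open>i\<^sub>k\<close> to \<open>- i\<^sub>k\<close>.
\<close>

definition degree_parity :: "'n multicomplex \<Rightarrow> 'n multicomplex" where
  "degree_parity x = Multicomplex (\<lambda>A. (- 1) ^ card A * mcoeff x A)"

lemma degree_parity_linear: "linear degree_parity"
  by (rule linearI; rule mc_eqI) (simp_all add: degree_parity_def algebra_simps)

lemma degree_parity_unit: "degree_parity (mc_unit A) = (- 1) ^ card A *\<^sub>R mc_unit A"
  by (rule mc_eqI) (simp add: degree_parity_def mcoeff_unit)

lemma degree_parity_involution: "degree_parity (degree_parity x) = x"
  by (rule mc_eqI) (simp add: degree_parity_def flip: power_add mult.assoc)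

lemma degree_parity_mult: "degree_parity (x * y) = degree_parity x * degree_parity y"
  for x y :: "'n::finite multicomplex"
proof (rule mc_eqI)
  fix C :: "'n set"
  have sign: "(- 1 :: real) ^ card C = (- 1) ^ card A * (- 1) ^ card (sym_diff A C)" for A
    using neg_one_card_Int[of A A] neg_one_card_Int[of C C] neg_one_card_Int[of "sym_diff A C" "sym_diff A C"]
    by (simp flip: prod.distrib) (rule prod.cong; auto)
  show "mcoeff (degree_parity (x * y)) C = mcoeff (degree_parity x * degree_parity y) C"
    unfolding degree_parity_def mcoeff_Multicomplex mcoeff_times sum_distrib_left
  proof (rule sum.cong[OF refl])
    fix A :: "'n set"
    show "(- 1) ^ card C * ((- 1) ^ card (A \<inter> sym_diff A C) * mcoeff x A * mcoeff y (sym_diff A C)) =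
        (- 1) ^ card (A \<inter> sym_diff A C) * ((- 1) ^ card A * mcoeff x A) *
        ((- 1) ^ card (sym_diff A C) * mcoeff y (sym_diff A C))"
      unfolding sign[of A] by (simp only: mult_ac)
  qed
qed

lemma mc_unit_square: "(mc_unit A)\<^sup>2 = (- 1) ^ card A *\<^sub>R 1"
  for A :: "'n::finite set"
  by (simp add: power2_eq_square mc_unit_mult one_multicomplex_def)

lemma mc_basis_imaginaryE:
  assumes "i \<in> mc_basis" and "i\<^sup>2 = - 1"
  obtains A where "i = mc_unit A" and "odd (card A)"
proof -
  from assms(1) obtain A where A: "i = mc_unit A" by (auto simp: mc_basis_eq)
  with assms(2) have "(- 1) ^ card A *\<^sub>R (1 :: 'a multicomplex) = - 1"
    by (simp add: mc_unit_square)
  then have "odd (card A)"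
    by (cases "even (card A)") (auto simp: mc_eq_iff one_multicomplex_def mcoeff_unit dest: spec[of _ "{}"])
  with A show thesis by (rule that)
qed

text \<open>
  Twist the grading by the even element \<open>u = - \<epsilon> i i'\<close>, for which \<open>u i = - \<epsilon> i\<^sup>2 i' = \<epsilon> i'\<close>. Up to
  sign \<open>u\<close> is a basis unit, and so the product of \<open>u\<close> with a basis unit is one as well.
\<close>

lemma ex_basis_preserving_automorphism:
  fixes i i' :: "'n::finite multicomplex"
  assumes i: "i \<in> mc_basis" "i\<^sup>2 = - 1" and i': "i' \<in> mc_basis" "i'\<^sup>2 = - 1"
    and \<epsilon>: "\<epsilon> \<in> {- 1, 1 :: real}"
  shows "\<exists>\<psi>. basis_preserving_automorphism \<psi> \<and> \<psi> i = \<epsilon> *\<^sub>R i'"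
proof -
  obtain A where A: "i = mc_unit A" "odd (card A)" by (rule mc_basis_imaginaryE[OF i])
  obtain A' where A': "i' = mc_unit A'" "odd (card A')" by (rule mc_basis_imaginaryE[OF i'])
  define u where "u = (- \<epsilon>) *\<^sub>R (i * i')"
  let ?\<psi> = "grading_twist degree_parity u"
  have sq: "i * i = - 1" "i' * i' = - 1" "\<epsilon> * \<epsilon> = 1"
    using i(2) i'(2) \<epsilon> by (auto simp: power2_eq_square)
  have odd: "degree_parity i = - i" "degree_parity i' = - i'"
    using A A' by (simp_all add: degree_parity_unit)
  have "u * u = (\<epsilon> * \<epsilon>) *\<^sub>R ((i * i) * (i' * i'))"
    by (simp add: u_def mult_ac)
  then have uu: "u * u = 1" by (simp add: sq)
  have "degree_parity u = u"
    by (simp add: u_def linear_scale[OF degree_parity_linear] linear_neg[OF degree_parity_linear]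
        degree_parity_mult odd)
  then have aut: "real_algebra_automorphism ?\<psi>"
    using uu degree_parity_unit[of "{}"]
    by (intro grading_twist_automorphism)
      (simp_all add: degree_parity_linear degree_parity_mult degree_parity_involution one_multicomplex_def)
  have "?\<psi> i = (- \<epsilon>) *\<^sub>R (i * i * i')"
    by (simp add: grading_twist_odd odd u_def mult_ac)
  then have "?\<psi> i = \<epsilon> *\<^sub>R i'" by (simp add: sq)
  moreover have "?\<psi> (mc_unit B) \<in> mc_basis \<union> uminus ` mc_basis" for B
  proof (cases "even (card B)")
    case True
    then show ?thesis by (simp add: grading_twist_even degree_parity_unit mc_basis_eq)
  next
    case False
    then have "?\<psi> (mc_unit B) = u * mc_unit B" by (simp add: grading_twist_odd degree_parity_unit)
    define D where "D = sym_diff (sym_diff A A') B"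
    define k where "k = card (A \<inter> A') + card (sym_diff A A' \<inter> B)"
    note \<open>?\<psi> (mc_unit B) = u * mc_unit B\<close>
    also have "u * mc_unit B = (- \<epsilon> * (- 1) ^ k) *\<^sub>R mc_unit D"
      by (simp add: u_def A A' mc_unit_mult power_add k_def D_def)
    finally have "?\<psi> (mc_unit B) = (- \<epsilon> * (- 1) ^ k) *\<^sub>R mc_unit D" .
    moreover have "- \<epsilon> * (- 1) ^ k \<in> {1, - 1}"
      using \<epsilon> by (cases "even k") auto
    ultimately have "?\<psi> (mc_unit B) = mc_unit D \<or> ?\<psi> (mc_unit B) = - mc_unit D"
      by auto
    then show ?thesis by (auto simp: mc_basis_eq)
  qed
  ultimately show ?thesis
    using aut unfolding basis_preserving_automorphism_def
    by (intro exI[of _ ?\<psi>]) (auto simp: mc_basis_eq)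
qed

section \<open>Post-composition with algebra homomorphisms\<close>

lemma comp_linear_C1:
  fixes F :: "'a::real_normed_vector \<Rightarrow> 'b::euclidean_space" and \<phi> :: "'b \<Rightarrow> 'c::real_normed_vector"
  assumes "F \<in> C1 U" and \<phi>: "linear \<phi>"
  shows "\<phi> \<circ> F \<in> C1 U"
    and "\<eta> \<in> U \<Longrightarrow> differential (\<phi> \<circ> F) \<eta> = \<phi> \<circ> differential F \<eta>"
proof -
  have bl: "bounded_linear \<phi>" using \<phi> by (simp add: linear_conv_bounded_linear)
  from assms(1) obtain F' :: "'a \<Rightarrow> 'a \<Rightarrow>\<^sub>L 'b" where
    F': "\<And>\<eta>. \<eta> \<in> U \<Longrightarrow> (F has_derivative F' \<eta>) (at \<eta>)" and cont: "continuous_on U F'"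
    by (auto simp: C1_def)
  have der: "(\<phi> \<circ> F has_derivative \<phi> \<circ> F' \<eta>) (at \<eta>)" if "\<eta> \<in> U" for \<eta>
    unfolding o_def by (rule bounded_linear.has_derivative[OF bl F'[OF that]])
  have "\<phi> \<circ> F' \<eta> = Blinfun \<phi> o\<^sub>L F' \<eta>" for \<eta>
    by (simp add: fun_eq_iff bounded_linear_Blinfun_apply[OF bl])
  with der have "\<forall>\<eta>\<in>U. (\<phi> \<circ> F has_derivative (Blinfun \<phi> o\<^sub>L F' \<eta>)) (at \<eta>)" by simp
  moreover have "continuous_on U (\<lambda>\<eta>. Blinfun \<phi> o\<^sub>L F' \<eta>)"
    by (intro bounded_bilinear.continuous_on[OF bounded_bilinear_blinfun_compose] cont continuous_on_const)
  ultimately show "\<phi> \<circ> F \<in> C1 U" 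
    unfolding C1_def by (intro CollectI exI[of _ "\<lambda>\<eta>. Blinfun \<phi> o\<^sub>L F' \<eta>"] conjI)
  show "differential (\<phi> \<circ> F) \<eta> = \<phi> \<circ> differential F \<eta>" if "\<eta> \<in> U"
    using frechet_derivative_at[OF der[OF that]] frechet_derivative_at[OF F'[OF that]] by simp
qed

text \<open>
  If \<open>DF (i v) = \<delta> j DF v\<close> then \<open>\<phi> (DF (i v)) = \<delta> \<phi>(j) \<phi> (DF v)\<close>, so that \<open>\<phi> \<circ> F\<close> is twisted by
  \<open>\<delta> \<phi>(j)\<close>. The factors \<open>\<delta>\<close> and \<open>\<delta>'\<close> are kept arbitrary in order to cover both \<open>\<psi>\<close>, from \<open>i\<close> to
  \<open>\<epsilon> i'\<close>, and its inverse.
\<close>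

lemma comp_hom_twisted_class:
  assumes F: "F \<in> twisted_class i j \<delta> U"
    and \<phi>: "linear \<phi>" "\<And>x y. \<phi> (x * y) = \<phi> x * \<phi> y"
    and eq: "\<delta> *\<^sub>R \<phi> j = \<delta>' *\<^sub>R j'"
  shows "\<phi> \<circ> F \<in> twisted_class i j' \<delta>' U"
proof -
  have C1: "F \<in> C1 U"
    and tw: "\<And>\<eta> v. \<eta> \<in> U \<Longrightarrow> differential F \<eta> (i * v) = \<delta> *\<^sub>R (j * differential F \<eta> v)"
    using F by (auto simp: twisted_class_def fun_eq_iff mc_L_def)
  have "\<phi> (\<delta> *\<^sub>R (j * y)) = \<delta>' *\<^sub>R (j' * \<phi> y)" for y
    using arg_cong[OF eq, of "\<lambda>z. z * \<phi> y"] by (simp add: linear_scale[OF \<phi>(1)] \<phi>(2))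
  then show ?thesis
    using comp_linear_C1[OF C1 \<phi>(1)] tw by (simp add: twisted_class_def fun_eq_iff mc_L_def)
qed

lemma Hol_eq_twisted_class: "Hol i U = twisted_class i i 1 U"
  by (simp add: Hol_def twisted_class_def o_def)

lemma twisted_class_eq_comp_Hol:
  assumes "real_algebra_automorphism \<psi>" and \<psi>: "\<psi> i = \<epsilon> *\<^sub>R i'"
  shows "twisted_class i i' \<epsilon> U = {\<psi> \<circ> G |G. G \<in> Hol i U}"
proof -
  have lin: "linear \<psi>" and mult: "\<And>x y. \<psi> (x * y) = \<psi> x * \<psi> y" and "bij \<psi>"
    using assms(1) by (auto simp: real_algebra_automorphism_def)
  have inv: "inv \<psi> (\<psi> x) = x" "\<psi> (inv \<psi> x) = x" for x
    using \<open>bij \<psi>\<close> by (simp_all add: bij_is_inj bij_is_surj surj_f_inv_f)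
  have lin': "linear (inv \<psi>)"
    by (rule linearI) (metis inv linear_add[OF lin], metis inv linear_scale[OF lin])
  have mult': "inv \<psi> (x * y) = inv \<psi> x * inv \<psi> y" for x y
    by (metis inv mult)
  show ?thesis
    unfolding Hol_eq_twisted_class
  proof (intro equalityI subsetI)
    fix F assume "F \<in> twisted_class i i' \<epsilon> U"
    then have "inv \<psi> \<circ> F \<in> twisted_class i i 1 U"
      by (rule comp_hom_twisted_class[OF _ lin' mult'])
        (simp add: inv flip: linear_scale[OF lin'] \<psi>)
    moreover have "F = \<psi> \<circ> (inv \<psi> \<circ> F)" by (simp add: fun_eq_iff inv)
    ultimately show "F \<in> {\<psi> \<circ> G |G. G \<in> twisted_class i i 1 U}" by blast
  next
    fix F assume "F \<in> {\<psi> \<circ> G |G. G \<in> twisted_class i i 1 U}"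
    then show "F \<in> twisted_class i i' \<epsilon> U"
      using comp_hom_twisted_class[OF _ lin mult, of _ i i 1 U \<epsilon> i'] \<psi> by auto
  qed
qed

section \<open>Twisted classes\<close>

text \<open>
  The case \<open>J v = i v\<close> and \<open>K y = \<epsilon> i' y\<close>, where \<open>K\<^sup>2 = \<epsilon>\<^sup>2 i'\<^sup>2 = -1\<close>.
\<close>

lemma twisted_class_real_analytic:
  assumes U: "open U" and i': "i'\<^sup>2 = - 1" and \<epsilon>: "\<epsilon> \<in> {- 1, 1}"
    and F: "F \<in> twisted_class i i' \<epsilon> U"
  shows "F real_analytic_on U"
proof (rule intertwining_imp_real_analytic_on[OF U])
  show "(F has_derivative differential F \<eta>) (at \<eta>)" if "\<eta> \<in> U" for \<eta>
    using F that unfolding twisted_class_def C1_def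
    by (auto simp: frechet_derivative_works[symmetric] differentiable_def)
  show "differential F \<eta> (mc_L i v) = \<epsilon> *\<^sub>R mc_L i' (differential F \<eta> v)" if "\<eta> \<in> U" for \<eta> v
    using F that by (auto simp: twisted_class_def fun_eq_iff)
  show "linear (\<lambda>v. \<epsilon> *\<^sub>R mc_L i' v)"
    by (rule linearI) (simp_all add: mc_L_def algebra_simps)
  have "\<epsilon> *\<^sub>R mc_L i' (\<epsilon> *\<^sub>R mc_L i' y) = (\<epsilon> * \<epsilon>) *\<^sub>R (i'\<^sup>2 * y)" for y
    by (simp add: mc_L_def power2_eq_square mult.assoc)
  then show "\<epsilon> *\<^sub>R mc_L i' (\<epsilon> *\<^sub>R mc_L i' y) = - y" for y
    using \<epsilon> i' by auto
qed

theorem proposition4p13: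
  fixes i i' :: "'n::finite multicomplex" and \<epsilon> :: real and U :: "'n multicomplex set"
  assumes "i \<in> mc_basis" and "i' \<in> mc_basis" and "i\<^sup>2 = - 1" and "i'\<^sup>2 = - 1"
    and "\<epsilon> \<in> {- 1, 1}" and "open U"
  shows "(\<exists>\<psi>. basis_preserving_automorphism \<psi> \<and> \<psi> i = \<epsilon> *\<^sub>R i') \<and>
    (\<forall>\<psi>. basis_preserving_automorphism \<psi> \<and> \<psi> i = \<epsilon> *\<^sub>R i' \<longrightarrow>
       twisted_class i i' \<epsilon> U = {\<psi> \<circ> G |G. G \<in> Hol i U}) \<and>
    (\<forall>F \<in> twisted_class i i' \<epsilon> U. F real_analytic_on U) \<and>
    (\<exists>\<psi>. basis_preserving_automorphism \<psi> \<and>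
       twisted_class i i' \<epsilon> U = {\<psi> \<circ> G |G. G \<in> Hol i U})"
proof -
  have eq: "twisted_class i i' \<epsilon> U = {\<psi> \<circ> G |G. G \<in> Hol i U}"
    if "basis_preserving_automorphism \<psi>" "\<psi> i = \<epsilon> *\<^sub>R i'" for \<psi>
    using that twisted_class_eq_comp_Hol unfolding basis_preserving_automorphism_def by blast
  have "F real_analytic_on U" if "F \<in> twisted_class i i' \<epsilon> U" for F
    using twisted_class_real_analytic that assms(4-6) by blast
  with eq ex_basis_preserving_automorphism[OF assms(1,3,2,4,5)] show ?thesis by blast
qed

end
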